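(* Let $\mathcal E$ be a nonempty set of e-variables. For any $\gamma\in(0,1]$ and $0<\delta<1/\gamma$, $$R_\gamma(\mathcal E^\delta)\le R_{\frac{\gamma}{1-\gamma\delta}}(\mathcal E)+\delta.$$
   Context: Fix a probability space with probability measure $\mathbb P$ and expectation $\mathbb E$. An e-variable is a $[0,\infty]$-valued random variable $E$ with $\mathbb E[E]\le 1$ (hence finite a.s.). For a set $\mathcal X$ of random variables and $\gamma>0$, $R_\gamma(\mathcal X)=\sup_{X\in\mathcal X}\mathbb P(X\ge 1/\gamma)$. For a random variable $X$, $\mu_X$ denotes its law on $\mathbb R$. The Lévy–Prokhorov metric between probability measures $\mu,\mu'$ on $\mathbb R$ is $$d_{\mathrm{LP}}(\mu,\mu')=\inf\{\delta>0:\ \mu(A)\le\mu'(A^\delta)+\delta\ \text{and}\ \mu'(A)\le\mu(A^\delta)+\delta\ \text{for all Borel }A\subseteq\mathbb R\},$$ where $A^\delta=\{x\in\mathbb R: |x-y|<\delta\text{ for some }y\in A\}$. For $\delta>0$, the $\delta$-neighbourhood of $\mathcal E$ is $$\mathcal E^\delta=\{E'\text{ a (real-valued) random variable}: d_{\mathrm{LP}}(\mu_E,\mu_{E'})<\delta\text{ for some }E\in\mathcal E\};$$ its elements need not be e-variables. *)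

theory Defs
  imports "HOL-Probability.Probability"
begin

text \<open>
  Random variables are extended-real-valued, so that \<open>[0,\<infinity>]\<close>-valued e-variables and
  real-valued random variables (embedded by \<open>ereal\<close>) share one type.
\<close>

definition e_variable :: "'a measure \<Rightarrow> ('a \<Rightarrow> ereal) \<Rightarrow> bool" where
  "e_variable M E \<longleftrightarrow>
     E \<in> borel_measurable M \<and> (\<forall>\<omega>\<in>space M. 0 \<le> E \<omega>) \<and> (\<integral>\<^sup>+\<omega>. e2ennreal (E \<omega>) \<partial>M) \<le> 1"

definition R_gamma :: "'a measure \<Rightarrow> real \<Rightarrow> ('a \<Rightarrow> ereal) set \<Rightarrow> real" where
  "R_gamma M \<gamma> \<X> = (SUP X\<in>\<X>. measure M {\<omega>\<in>space M. X \<omega> \<ge> ereal (1 / \<gamma>)})"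

text \<open>
  The law on the real line of an almost surely finite random variable. Since \<open>real_of_ereal\<close>
  sends infinite values to \<open>0\<close>, it is meaningful only in that case; see \<open>measure_law\<close> and
  \<open>e_variable_AE_finite\<close> below.
\<close>

definition law :: "'a measure \<Rightarrow> ('a \<Rightarrow> ereal) \<Rightarrow> real measure" where
  "law M X = distr M borel (\<lambda>\<omega>. real_of_ereal (X \<omega>))"

definition nbhd :: "real \<Rightarrow> real set \<Rightarrow> real set" where
  "nbhd \<delta> A = {x. \<exists>y\<in>A. \<bar>x - y\<bar> < \<delta>}"

definition d_LP :: "real measure \<Rightarrow> real measure \<Rightarrow> real" where
  "d_LP \<mu> \<mu>' = Inf {\<delta>. \<delta> > 0 \<and> (\<forall>A\<in>sets borel.
     measure \<mu> A \<le> measure \<mu>' (nbhd \<delta> A) + \<delta> \<and>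
     measure \<mu>' A \<le> measure \<mu> (nbhd \<delta> A) + \<delta>)}"

definition LP_neighbourhood ::
    "'a measure \<Rightarrow> real \<Rightarrow> ('a \<Rightarrow> ereal) set \<Rightarrow> ('a \<Rightarrow> ereal) set" where
  "LP_neighbourhood M \<delta> \<E> =
     {(\<lambda>\<omega>. ereal (Y \<omega>)) | Y :: 'a \<Rightarrow> real. Y \<in> borel_measurable M \<and>
        (\<exists>E\<in>\<E>. d_LP (law M E) (law M (\<lambda>\<omega>. ereal (Y \<omega>))) < \<delta>)}"

lemma e_variable_AE_finite:
  assumes "e_variable M E"
  shows "AE \<omega> in M. \<bar>E \<omega>\<bar> \<noteq> \<infinity>"
proof -
  have m [measurable]: "E \<in> borel_measurable M"
    and nn: "\<forall>\<omega>\<in>space M. 0 \<le> E \<omega>"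
    and le: "(\<integral>\<^sup>+\<omega>. e2ennreal (E \<omega>) \<partial>M) \<le> 1"
    using assms by (auto simp: e_variable_def)
  have "(\<integral>\<^sup>+\<omega>. e2ennreal (E \<omega>) \<partial>M) \<noteq> \<infinity>"
    using le by (auto simp: top_unique)
  then have "AE \<omega> in M. e2ennreal (E \<omega>) \<noteq> \<infinity>"
    by (intro nn_integral_PInf_AE) auto
  moreover have "AE \<omega> in M. 0 \<le> E \<omega>"
    using nn by (intro AE_I2) auto
  ultimately show ?thesis
  proof eventually_elim
    case (elim \<omega>)
    then show ?case by (cases "E \<omega>") auto
  qed
qed

lemma measure_law:
  assumes [measurable]: "X \<in> borel_measurable M"
    and fin: "AE \<omega> in M. \<bar>X \<omega>\<bar> \<noteq> \<infinity>" and A [measurable]: "A \<in> sets borel"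
  shows "measure (law M X) A = measure M {\<omega>\<in>space M. X \<omega> \<in> ereal ` A}"
proof -
  have [measurable]: "ereal ` A \<in> sets borel"
  proof -
    have "ereal ` A = {x \<in> space borel. \<bar>x\<bar> \<noteq> \<infinity> \<and> real_of_ereal x \<in> A}"
      by (force simp: image_iff ereal_real)
    also have "\<dots> \<in> sets borel" by measurable
    finally show ?thesis .
  qed
  have "measure (law M X) A = measure M {\<omega>\<in>space M. real_of_ereal (X \<omega>) \<in> A}"
    unfolding law_def by (subst measure_distr) (auto intro!: arg_cong[where f="measure M"])
  also have "\<dots> = measure M {\<omega>\<in>space M. X \<omega> \<in> ereal ` A}"
  proof (rule measure_eq_AE)
    show "AE \<omega> in M. (\<omega> \<in> {\<omega>\<in>space M. real_of_ereal (X \<omega>) \<in> A}) =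
        (\<omega> \<in> {\<omega>\<in>space M. X \<omega> \<in> ereal ` A})"
      using fin by eventually_elim (auto simp: image_iff)
  qed measurable
  finally show ?thesis .
qed

end

theory Submission
  imports Defs
begin

text \<open>
  If \<open>Y\<close> lies within Levy--Prokhorov distance less than \<open>\<delta>\<close> of an e-variable \<open>E\<close>, the defining
  inequality of the metric for the half-line \<open>{1/\<gamma>..}\<close> moves the event \<open>Y \<ge> 1/\<gamma>\<close> to an event
  about \<open>E\<close> at the cost of an additive \<open>\<delta>\<close>. The \<open>\<delta>\<close>-neighbourhood of that half-line is the open
  half-line above \<open>1/\<gamma> - \<delta>\<close>, and \<open>1/\<gamma> - \<delta>\<close> is exactly the threshold that belongs to the level
  \<open>\<gamma> / (1 - \<gamma> * \<delta>)\<close>. Taking the supremum over \<open>Y\<close> gives the bound.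

  Two points need care. The metric is an infimum, so the inequality is first obtained at some
  smaller radius and then enlarged (\<open>measure_le_nbhd_if_d_LP_less\<close>). The supremum of an empty set
  of reals is unspecified, so the neighbourhood must be shown to be nonempty
  (\<open>LP_neighbourhood_nonempty\<close>).
\<close>

lemma open_nbhd: "open (nbhd \<delta> A)"
proof -
  have "nbhd \<delta> A = (\<Union>y\<in>A. ball y \<delta>)"
    by (auto simp: nbhd_def dist_real_def abs_minus_commute)
  then show ?thesis by (simp add: open_UN)
qed

lemma nbhd_mono: "\<delta> \<le> \<delta>' \<Longrightarrow> nbhd \<delta> A \<subseteq> nbhd \<delta>' A"
  by (force simp: nbhd_def)

lemma subset_nbhd: "0 < \<delta> \<Longrightarrow> A \<subseteq> nbhd \<delta> A"
  by (force simp: nbhd_def)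

lemma nbhd_atLeast_subset: "nbhd \<delta> {c..} \<subseteq> {c - \<delta><..}"
  by (auto simp: nbhd_def)

text \<open>
  Every radius that is at least \<open>1\<close> is admissible for two probability measures, so the infimum
  in the metric is over a nonempty set; hence some admissible radius lies below \<open>\<delta>\<close>.
\<close>

lemma measure_le_nbhd_if_d_LP_less:
  assumes "prob_space \<mu>" and "prob_space \<mu>'" and sets: "sets \<mu> = sets borel"
    and d: "d_LP \<mu> \<mu>' < \<delta>" and A: "A \<in> sets borel"
  shows "measure \<mu>' A \<le> measure \<mu> (nbhd \<delta> A) + \<delta>"
proof -
  interpret \<mu>: prob_space \<mu> by fact
  interpret \<mu>': prob_space \<mu>' by fact
  let ?S = "{\<epsilon>. \<epsilon> > 0 \<and> (\<forall>A\<in>sets borel.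
     measure \<mu> A \<le> measure \<mu>' (nbhd \<epsilon> A) + \<epsilon> \<and> measure \<mu>' A \<le> measure \<mu> (nbhd \<epsilon> A) + \<epsilon>)}"
  have "1 \<in> ?S"
    by (simp add: add_increasing)
  then have "?S \<noteq> {}" by blast
  then obtain \<epsilon> where "\<epsilon> \<in> ?S" and "\<epsilon> < \<delta>"
    using cInf_lessD[of ?S \<delta>] d unfolding d_LP_def by blast
  then have "measure \<mu>' A \<le> measure \<mu> (nbhd \<epsilon> A) + \<epsilon>"
    using A by auto
  also have "\<dots> \<le> measure \<mu> (nbhd \<delta> A) + \<delta>"
    using \<open>\<epsilon> < \<delta>\<close> open_nbhd
    by (intro add_mono \<mu>.finite_measure_mono nbhd_mono) (auto simp: sets)
  finally show ?thesis .
qed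

lemma d_LP_self_less:
  assumes "prob_space \<mu>" and sets: "sets \<mu> = sets borel" and "0 < \<delta>"
  shows "d_LP \<mu> \<mu> < \<delta>"
proof -
  interpret \<mu>: prob_space \<mu> by fact
  have "measure \<mu> A \<le> measure \<mu> (nbhd (\<delta> / 2) A) + \<delta> / 2" if "A \<in> sets borel" for A
  proof -
    have "measure \<mu> A \<le> measure \<mu> (nbhd (\<delta> / 2) A)"
      using \<open>0 < \<delta>\<close> open_nbhd
      by (intro \<mu>.finite_measure_mono subset_nbhd) (auto simp: sets)
    then show ?thesis using \<open>0 < \<delta>\<close> by simp
  qed
  then have "d_LP \<mu> \<mu> \<le> \<delta> / 2"
    unfolding d_LP_def using \<open>0 < \<delta>\<close>
    by (intro cInf_lower) (auto intro!: bdd_belowI[where m = 0])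
  then show ?thesis using \<open>0 < \<delta>\<close> by simp
qed

lemma prob_space_law:
  assumes "prob_space M" and "X \<in> borel_measurable M"
  shows "prob_space (law M X)"
  unfolding law_def using assms by (intro prob_space.prob_space_distr) auto

text \<open>
  Replacing infinite values by \<open>0\<close> turns a member of \<open>\<E>\<close> into a real-valued random variable with
  the same law, which is therefore at distance \<open>0\<close> from it.
\<close>

lemma LP_neighbourhood_nonempty:
  assumes "prob_space M" and "E \<in> \<E>" and [measurable]: "E \<in> borel_measurable M" and "0 < \<delta>"
  shows "LP_neighbourhood M \<delta> \<E> \<noteq> {}"
proof -
  define Y where "Y = (\<lambda>\<omega>. real_of_ereal (E \<omega>))"
  have "law M (\<lambda>\<omega>. ereal (Y \<omega>)) = law M E"
    by (simp add: law_def Y_def)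
  moreover have "d_LP (law M E) (law M E) < \<delta>"
    using assms by (intro d_LP_self_less prob_space_law) (auto simp: law_def)
  moreover have "Y \<in> borel_measurable M"
    unfolding Y_def by measurable
  ultimately have "(\<lambda>\<omega>. ereal (Y \<omega>)) \<in> LP_neighbourhood M \<delta> \<E>"
    using \<open>E \<in> \<E>\<close> unfolding LP_neighbourhood_def by (auto intro!: exI[of _ Y] bexI[of _ E])
  then show ?thesis by blast
qed

text \<open>
  The law of \<open>E\<close> records infinite outcomes as the value \<open>0\<close>. As \<open>c - \<delta>\<close> is nonnegative, that value
  lies outside the open half-line above \<open>c - \<delta>\<close>, so the mass which the law gives to this half-line
  is at most the tail probability of \<open>E\<close> itself.
\<close>

lemma tail_le_if_d_LP_less:
  assumes "prob_space M"
    and [measurable]: "E \<in> borel_measurable M" "Y \<in> borel_measurable M"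
    and d: "d_LP (law M E) (law M (\<lambda>\<omega>. ereal (Y \<omega>))) < \<delta>" and "\<delta> \<le> c"
  shows "measure M {\<omega>\<in>space M. ereal c \<le> ereal (Y \<omega>)}
           \<le> measure M {\<omega>\<in>space M. ereal (c - \<delta>) \<le> E \<omega>} + \<delta>"
proof -
  interpret prob_space M by fact
  have nbhd [measurable]: "nbhd \<delta> {c..} \<in> sets borel"
    using open_nbhd by simp
  have "measure M {\<omega>\<in>space M. ereal c \<le> ereal (Y \<omega>)} = measure (law M (\<lambda>\<omega>. ereal (Y \<omega>))) {c..}"
    unfolding law_def by (subst measure_distr) (auto intro!: arg_cong[where f = "measure M"])
  also have "\<dots> \<le> measure (law M E) (nbhd \<delta> {c..}) + \<delta>"
    using d by (intro measure_le_nbhd_if_d_LP_less prob_space_law prob_space_axioms)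
      (auto simp: law_def)
  also have "measure (law M E) (nbhd \<delta> {c..})
      = measure M {\<omega>\<in>space M. real_of_ereal (E \<omega>) \<in> nbhd \<delta> {c..}}"
    unfolding law_def by (subst measure_distr) (auto intro!: arg_cong[where f = "measure M"])
  also have "\<dots> \<le> measure M {\<omega>\<in>space M. ereal (c - \<delta>) \<le> E \<omega>}"
  proof (rule finite_measure_mono)
    have "ereal (c - \<delta>) \<le> x" if "real_of_ereal x \<in> nbhd \<delta> {c..}" for x
      using that nbhd_atLeast_subset[of \<delta> c] \<open>\<delta> \<le> c\<close> by (cases x) auto
    then show "{\<omega>\<in>space M. real_of_ereal (E \<omega>) \<in> nbhd \<delta> {c..}}
        \<subseteq> {\<omega>\<in>space M. ereal (c - \<delta>) \<le> E \<omega>}" by blast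
  qed measurable
  finally show ?thesis by simp
qed

theorem proposition2:
  fixes M :: "'a measure" and \<E> :: "('a \<Rightarrow> ereal) set" and \<gamma> \<delta> :: real
  assumes "prob_space M"
    and "\<E> \<noteq> {}"
    and "\<forall>E\<in>\<E>. e_variable M E"
    and "0 < \<gamma>" and "\<gamma> \<le> 1"
    and "0 < \<delta>" and "\<delta> < 1 / \<gamma>"
  shows "R_gamma M \<gamma> (LP_neighbourhood M \<delta> \<E>) \<le> R_gamma M (\<gamma> / (1 - \<gamma> * \<delta>)) \<E> + \<delta>"
proof -
  interpret prob_space M by fact
  have meas: "E \<in> borel_measurable M" if "E \<in> \<E>" for E
    using that assms(3) by (auto simp: e_variable_def)
  have threshold: "1 / (\<gamma> / (1 - \<gamma> * \<delta>)) = 1 / \<gamma> - \<delta>"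
    using \<open>0 < \<gamma>\<close> by (simp add: field_simps)
  show ?thesis
    unfolding R_gamma_def[of M \<gamma>]
  proof (rule cSUP_least)
    show "LP_neighbourhood M \<delta> \<E> \<noteq> {}"
      using assms(2) meas LP_neighbourhood_nonempty[OF \<open>prob_space M\<close> _ _ \<open>0 < \<delta>\<close>] by blast
  next
    fix X assume "X \<in> LP_neighbourhood M \<delta> \<E>"
    then obtain Y E where X: "X = (\<lambda>\<omega>. ereal (Y \<omega>))" and Y: "Y \<in> borel_measurable M"
      and E: "E \<in> \<E>" and d: "d_LP (law M E) (law M (\<lambda>\<omega>. ereal (Y \<omega>))) < \<delta>"
      by (auto simp: LP_neighbourhood_def)
    have "measure M {\<omega>\<in>space M. ereal (1 / \<gamma>) \<le> X \<omega>}
        \<le> measure M {\<omega>\<in>space M. ereal (1 / \<gamma> - \<delta>) \<le> E \<omega>} + \<delta>"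
      unfolding X using assms(7) by (intro tail_le_if_d_LP_less assms(1) meas E Y d) simp
    also have "measure M {\<omega>\<in>space M. ereal (1 / \<gamma> - \<delta>) \<le> E \<omega>}
        \<le> R_gamma M (\<gamma> / (1 - \<gamma> * \<delta>)) \<E>"
      unfolding R_gamma_def threshold
      by (intro cSUP_upper E bdd_aboveI[where M = 1]) auto
    finally show "measure M {\<omega>\<in>space M. ereal (1 / \<gamma>) \<le> X \<omega>}
        \<le> R_gamma M (\<gamma> / (1 - \<gamma> * \<delta>)) \<E> + \<delta>" by simp
  qed
qed

end
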